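(* For every $\eta>0$ and every deterministic online policy $\pi$, there exist a matching-cost function $f:\mathbb{Z}_+^N\to\mathbb{R}_+$ that is positive, finite and componentwise non-increasing on $\mathcal F=\{\mathbf{x}\in\mathbb{Z}_+^N:\min_i x_i\ge1\}$ and a finite balanced complete-tuple arrival sequence such that $$\frac{J^\pi}{J^{OPT}}\ge 2-\eta.$$ Consequently, no deterministic online algorithm can achieve a uniform competitive ratio strictly smaller than $2$ over the class of monotone complete-tuple matching-cost functions.
   Context: **Model.** There are $N\ge2$ agent types with waiting-cost rates $c_1,\dots,c_N>0$. Agents of each type arrive over continuous time $t\ge0$ (arbitrary arrival times, finitely many in any finite interval). The state $\mathbf{X}(t)\in\mathbb{Z}_+^N$ records the number of unmatched agents of each type; the system starts empty. A type-$i$ arrival changes the state by $\mathbf{X}\leftarrow\mathbf{X}+\mathbf{e}_i$. A match (of one complete tuple, one agent of each type) is feasible iff $\mathbf{X}\in\mathcal F$, and changes the state by $\mathbf{X}\leftarrow\mathbf{X}-\mathbf{1}$. A policy may execute matches at any calendar times (several matches at one time are allowed). Events are processed one at a time; simultaneous arrivals are processed in an arbitrary but fixed order and a policy may re-evaluate its decision after each individual arrival. A deterministic online policy knows $N$, the $c_i$ and $f$, and its decisions at any time are a deterministic function of the arrivals and matches so far (and of elapsed time); it has no knowledge of future arrivals, including whether any remain. **Costs.** The waiting-cost rate in state $\mathbf{x}$ is $w(\mathbf{x})=\sum_i c_ix_i$. The $k$-th match of policy $\pi$, executed at time $\tau_k^\pi$, costs $f(\mathbf{Y}_k^\pi)$,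 where $\mathbf{Y}_k^\pi$ is the pre-match state. Monotone (componentwise non-increasing) means: $f(\mathbf{x})\le f(\mathbf{y})$ whenever $\mathbf{x},\mathbf{y}\in\mathcal F$, $\mathbf{x}\succeq\mathbf{y}$; positive and finite means $0<f(\mathbf{x})<\infty$ on $\mathcal F$. **Finite balanced instance.** The finite arrival sequence contains exactly $K$ arrivals of each type, for some integer $K$. A policy that fails to execute all $K$ matches has cost $+\infty$; otherwise $J^\pi=\int_0^{\tau_K^\pi}w(\mathbf{X}^\pi(t))\,dt+\sum_{k=1}^K f(\mathbf{Y}_k^\pi)$. $J^{OPT}$ is the minimum total cost over offline policies knowing the whole arrival sequence in advance. A policy has uniform competitive ratio $\rho$ if $J^\pi\le\rho J^{OPT}$ for all such $f$ and all finite balanced arrival sequences. *)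

theory Defs
  imports "HOL-Analysis.Analysis"
begin

type_synonym 'n state = "'n \<Rightarrow> nat"

text \<open>The order of the list is the order in which simultaneous arrivals are processed.\<close>

type_synonym 'n arrivals = "(real \<times> 'n) list"

datatype 'n event = Arrival (time: real) 'n | Match (time: real)

text \<open>A history is the chronological list of events (arrivals and matches) processed so far.\<close>

type_synonym 'n history = "'n event list"

definition feasible :: "('n::finite) state set" where
  "feasible = {x. \<forall>i. 1 \<le> x i}"

primrec apply_event :: "'n event \<Rightarrow> 'n state \<Rightarrow> 'n state" where
  "apply_event (Arrival t i) x = x(i := x i + 1)"
| "apply_event (Match t) x = (\<lambda>i. x i - 1)"

definition state_after :: "'n history \<Rightarrow> 'n state" where
  "state_after h = fold apply_event h (\<lambda>_. 0)"

definition arrivals_of :: "'n history \<Rightarrow> 'n arrivals" where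
  "arrivals_of h = concat (map (\<lambda>e. case e of Arrival t i \<Rightarrow> [(t, i)] | Match t \<Rightarrow> []) h)"

definition match_times :: "'n history \<Rightarrow> real list" where
  "match_times h = concat (map (\<lambda>e. case e of Arrival t i \<Rightarrow> [] | Match t \<Rightarrow> [t]) h)"

definition cost_function :: "(('n::finite) state \<Rightarrow> real) \<Rightarrow> bool" where
  "cost_function f \<longleftrightarrow>
     (\<forall>x. 0 \<le> f x) \<and> (\<forall>x\<in>feasible. 0 < f x) \<and>
     (\<forall>x\<in>feasible. \<forall>y\<in>feasible. y \<le> x \<longrightarrow> f x \<le> f y)"

definition balanced :: "nat \<Rightarrow> 'n arrivals \<Rightarrow> bool" where
  "balanced K A \<longleftrightarrow>
     sorted (map fst A) \<and> (\<forall>a\<in>set A. 0 \<le> fst a) \<and>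
     (\<forall>i. length (filter (\<lambda>a. snd a = i) A) = K)"

definition waiting_rate :: "(('n::finite) \<Rightarrow> real) \<Rightarrow> 'n state \<Rightarrow> real" where
  "waiting_rate c x = (\<Sum>i\<in>UNIV. c i * real (x i))"

text \<open>The state at calendar time \<open>t\<close>, once all events of time at most \<open>t\<close> have been processed.\<close>

definition state_at :: "'n history \<Rightarrow> real \<Rightarrow> 'n state" where
  "state_at h t = state_after (filter (\<lambda>e. time e \<le> t) h)"

text \<open>The sum of \<open>f\<close> over the pre-match states, starting from state \<open>x\<close>.\<close>

fun matching_cost :: "('n state \<Rightarrow> real) \<Rightarrow> 'n state \<Rightarrow> 'n history \<Rightarrow> real" where
  "matching_cost f x [] = 0"
| "matching_cost f x (Arrival t i # h) = matching_cost f (apply_event (Arrival t i) x) h"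
| "matching_cost f x (Match t # h) = f x + matching_cost f (apply_event (Match t) x) h"

text \<open>The total cost of a complete history in an instance with \<open>K\<close> arrivals of each type;
  the leading \<open>0\<close> only serves to make the time of the last match meaningful for \<open>K = 0\<close>.\<close>

definition total_cost ::
  "(('n::finite) \<Rightarrow> real) \<Rightarrow> ('n state \<Rightarrow> real) \<Rightarrow> nat \<Rightarrow> 'n history \<Rightarrow> ereal" where
  "total_cost c f K h =
     (if length (match_times h) = K
      then ereal (integral {0..last (0 # match_times h)} (\<lambda>t. waiting_rate c (state_at h t))
                  + matching_cost f (\<lambda>_. 0) h)
      else \<infinity>)"

text \<open>Offline, every interleaving of the given arrivals with feasible matches is available; the
  position of a match in the history also fixes its order relative to simultaneous arrivals.\<close>

definition offline_histories :: "('n::finite) arrivals \<Rightarrow> 'n history set" where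
  "offline_histories A =
     {h. arrivals_of h = A \<and> sorted (map time h) \<and> (\<forall>e\<in>set h. 0 \<le> time e) \<and>
         (\<forall>k<length h. \<forall>t. h ! k = Match t \<longrightarrow> state_after (take k h) \<in> feasible)}"

definition J_OPT ::
  "(('n::finite) \<Rightarrow> real) \<Rightarrow> ('n state \<Rightarrow> real) \<Rightarrow> nat \<Rightarrow> 'n arrivals \<Rightarrow> ereal" where
  "J_OPT c f K A = (INF h\<in>offline_histories A. total_cost c f K h)"

text \<open>Between two events the only new information is the elapsed time, so what an online policy
  does after a history is determined by the time at which it will execute its next match, should
  no arrival come first. It is asked again after every single arrival and every match.
  \<open>Match_at t\<close> takes place at time \<open>t\<close> before any arrival at time \<open>t\<close> that is still to be
  processed; \<open>Match_after t\<close> takes place at time \<open>t\<close> only if no such arrival turns up.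
  A time that has already passed stands for an immediate match, and a planned match is
  disregarded while infeasible, so every function below is an online policy.\<close>

datatype plan = Wait | Match_at real | Match_after real

type_synonym 'n policy = "'n history \<Rightarrow> plan"

definition current_time :: "'n history \<Rightarrow> real" where
  "current_time h = last (0 # map time h)"

text \<open>The time of the next match if it precedes the next of the future arrivals \<open>A\<close>.\<close>

fun next_match :: "plan \<Rightarrow> real \<Rightarrow> 'n arrivals \<Rightarrow> real option" where
  "next_match Wait now A = None"
| "next_match (Match_at t) now A =
     (if A = [] \<or> max now t \<le> fst (hd A) then Some (max now t) else None)"
| "next_match (Match_after t) now A =
     (if A = [] \<or> max now t < fst (hd A) then Some (max now t) else None)"

text \<open>\<open>online_run p h A\<close> continues the history \<open>h\<close> under the policy \<open>p\<close> when the
  arrivals \<open>A\<close> are still to come. The policy itself only ever sees the history.\<close>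

function online_run :: "('n::finite) policy \<Rightarrow> 'n history \<Rightarrow> 'n arrivals \<Rightarrow> 'n history" where
  "online_run p h A =
     (case (if state_after h \<in> feasible then next_match (p h) (current_time h) A else None) of
        Some t \<Rightarrow> online_run p (h @ [Match t]) A
      | None \<Rightarrow> (case A of [] \<Rightarrow> h | (t, i) # A' \<Rightarrow> online_run p (h @ [Arrival t i]) A'))"
  by pat_completeness auto
termination
proof (relation "Wellfounded.measure (\<lambda>(p, h, A). 2 * length A + (\<Sum>i\<in>UNIV. state_after h i))", goal_cases)
  case 1
  then show ?case by simp
next
  case (2 p h A a A' t i)
  have "(\<Sum>j\<in>UNIV. ((state_after h)(i := state_after h i + 1)) j) =
        (\<Sum>j\<in>UNIV. state_after h j + (if j = i then 1 else 0))"
    by (rule sum.cong) auto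
  also have "\<dots> = (\<Sum>j\<in>UNIV. state_after h j) + 1"
    by (simp add: sum.distrib)
  finally show ?case using 2 by (simp add: state_after_def)
next
  case (3 p h A t)
  then have "state_after h \<in> feasible" by (auto split: if_splits)
  then have "\<forall>i. 1 \<le> state_after h i" by (simp add: feasible_def)
  then have "(\<Sum>i\<in>UNIV. state_after h i - 1) < (\<Sum>i\<in>UNIV. state_after h i)"
    by (intro sum_strict_mono) (auto simp: less_eq_Suc_le)
  then show ?case by (simp add: state_after_def)
qed

declare online_run.simps [simp del]

definition J_online ::
  "(('n::finite) \<Rightarrow> real) \<Rightarrow> ('n state \<Rightarrow> real) \<Rightarrow> 'n policy \<Rightarrow> nat \<Rightarrow> 'n arrivals \<Rightarrow> ereal" where
  "J_online c f p K A = total_cost c f K (online_run p [] A)"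

text \<open>An online policy knows the matching-cost function, hence the argument \<open>p f\<close>.\<close>

definition uniform_competitive_ratio ::
  "(('n::finite) \<Rightarrow> real) \<Rightarrow> (('n state \<Rightarrow> real) \<Rightarrow> 'n policy) \<Rightarrow> real \<Rightarrow> bool" where
  "uniform_competitive_ratio c p \<rho> \<longleftrightarrow>
     (\<forall>f K A. cost_function f \<longrightarrow> balanced K A \<longrightarrow>
        J_online c f (p f) K A \<le> ereal \<rho> * J_OPT c f K A)"

end

theory Submission
  imports Defs
begin

text \<open>
  Let \<open>f\<close> be \<open>1\<close> at the all-ones state and \<open>\<epsilon>\<close> elsewhere. The adversary releases a complete tuple a
  moment \<open>\<delta>\<close> after each match of the policy, so the policy always faces the all-ones state and pays
  \<open>1\<close> for every match. If it waits forever, the adversary stops and the cost is infinite. Otherwise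
  the policy pays \<open>W + N\<close> for \<open>N\<close> tuples, where \<open>W\<close> is its waiting cost. Offline, one may match every
  tuple on arrival, at cost \<open>N\<close>, or keep one tuple in reserve throughout, so that all matches but the
  last cost \<open>\<epsilon>\<close>, at total cost at most \<open>W + 2\<close> for small \<open>\<delta>\<close> and \<open>\<epsilon>\<close>. Whatever \<open>W\<close> is,
  \<open>W + N\<close> is at least \<open>2 - 2 / N\<close> times the smaller of these two costs.
\<close>

section \<open>Complete tuples and bookkeeping on histories\<close>

definition types :: "'n::finite list" where
  "types = (SOME xs. set xs = UNIV \<and> distinct xs)"

lemma set_types [simp]: "set (types :: 'n::finite list) = UNIV"
  and distinct_types [simp]: "distinct (types :: 'n list)"
proof -
  have "\<exists>xs :: 'n list. set xs = UNIV \<and> distinct xs"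
    by (rule finite_distinct_list) simp
  then have "set (types :: 'n list) = UNIV \<and> distinct (types :: 'n list)"
    unfolding types_def by (rule someI_ex)
  then show "set (types :: 'n list) = UNIV" "distinct (types :: 'n list)" by auto
qed

lemma types_not_Nil [simp]: "types \<noteq> []"
  by (metis set_types empty_set UNIV_not_empty)

definition tuple :: "real \<Rightarrow> 'n::finite history" where
  "tuple s = map (Arrival s) types"

lemma tuple_not_Nil [simp]: "tuple s \<noteq> []"
  by (simp add: tuple_def)

lemma time_tuple: "e \<in> set (tuple s) \<Longrightarrow> time e = s"
  by (auto simp: tuple_def)

lemma map_time_tuple: "map time (tuple s :: 'n::finite history) = replicate (length (types :: 'n list)) s"
  by (simp add: tuple_def comp_def map_replicate_const)

lemma last_times_tuple [simp]: "last (a # map time (tuple s :: 'n::finite history)) = s"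
  by (simp add: map_time_tuple)

text \<open>Throughout, \<open>last (a # map time h)\<close> is the clock reading after a history
  \<open>h\<close> begun at time \<open>a\<close>; the leading \<open>a\<close> covers an empty
  \<open>h\<close>.\<close>

lemma last_times_append:
  "last (a # map time (h @ h')) = last (last (a # map time h) # map time h')"
  by (auto simp: last_append)

lemma fold_arrivals:
  "distinct is \<Longrightarrow> fold apply_event (map (Arrival s) is) x = (\<lambda>i. x i + (if i \<in> set is then 1 else 0))"
  by (induction "is" arbitrary: x) (auto simp: fun_eq_iff)

lemma fold_tuple [simp]: "fold apply_event (tuple s) x = (\<lambda>i. x i + 1)"
  by (simp add: tuple_def fold_arrivals)

lemma arrivals_of_append [simp]: "arrivals_of (h @ h') = arrivals_of h @ arrivals_of h'"
  by (simp add: arrivals_of_def)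

lemma match_times_append [simp]: "match_times (h @ h') = match_times h @ match_times h'"
  by (simp add: match_times_def)

lemma arrivals_of_simps [simp]:
  "arrivals_of [] = []" "arrivals_of (Arrival t i # h) = (t, i) # arrivals_of h"
  "arrivals_of (Match t # h) = arrivals_of h"
  by (simp_all add: arrivals_of_def)

lemma match_times_simps [simp]:
  "match_times [] = []" "match_times (Arrival t i # h) = match_times h"
  "match_times (Match t # h) = t # match_times h"
  by (simp_all add: match_times_def)

lemma arrivals_of_tuple: "arrivals_of (tuple s) = map (Pair s) types"
proof -
  have "arrivals_of (map (Arrival s) is) = map (Pair s) is" for "is" :: "'a list"
    by (induction "is") auto
  then show ?thesis by (simp add: tuple_def)
qed

lemma match_times_tuple [simp]: "match_times (tuple s) = []"
proof -
  have "match_times (map (Arrival s) is) = []" for "is" :: "'a list"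
    by (induction "is") auto
  then show ?thesis by (simp add: tuple_def)
qed

lemma state_after_append: "state_after (h @ h') = fold apply_event h' (state_after h)"
  by (simp add: state_after_def)

lemma current_time_append: "current_time (h @ h') = last (current_time h # map time h')"
  by (simp only: current_time_def last_times_append)

subsection \<open>The cost of a history\<close>

text \<open>Replaces the integral in \<open>total_cost\<close> by a recursion over events that
  splits under concatenation, so that costs can be computed round by round. A zero \<open>f\<close>
  isolates the waiting cost.\<close>

primrec run_cost ::
  "(('n::finite) \<Rightarrow> real) \<Rightarrow> ('n state \<Rightarrow> real) \<Rightarrow> 'n state \<Rightarrow> real \<Rightarrow> 'n history \<Rightarrow> real" where
  "run_cost c f x a [] = 0"
| "run_cost c f x a (e # h) = (time e - a) * waiting_rate c x + matching_cost f x [e]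
     + run_cost c f (apply_event e x) (time e) h"

lemma run_cost_append:
  "run_cost c f x a (h @ h') =
     run_cost c f x a h + run_cost c f (fold apply_event h x) (last (a # map time h)) h'"
  by (induction h arbitrary: x a) auto

lemma last_times_ge: "sorted (a # map time h) \<Longrightarrow> a \<le> last (a # map time h)"
  by (metis last_in_set list.distinct(1) order_refl set_ConsD sorted_simps(2))

lemma has_integral_waiting_rate:
  assumes "sorted (a # map time h)"
  shows "((\<lambda>t. waiting_rate c (fold apply_event (filter (\<lambda>e. time e \<le> t) h) x)) has_integral
      run_cost c (\<lambda>_. 0) x a h) {a..last (a # map time h)}"
  using assms
proof (induction h arbitrary: x a)
  case Nil
  then show ?case using has_integral_const_real[of "waiting_rate c x" a a] by simp
next
  case (Cons e h)
  let ?g = "\<lambda>t. waiting_rate c (fold apply_event (filter (\<lambda>e. time e \<le> t) (e # h)) x)"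
  have srt: "sorted (time e # map time h)" and ae: "a \<le> time e" using Cons.prems by auto
  have 1: "(?g has_integral (time e - a) * waiting_rate c x) {a..time e}"
  \<comment> \<open>At the right endpoint \<open>e\<close> already counts as processed, so the
    integrand may jump there; one point is negligible.\<close>
  proof (rule has_integral_spike_finite[where S="{time e}"])
    show "((\<lambda>_. waiting_rate c x) has_integral (time e - a) * waiting_rate c x) {a..time e}"
      using has_integral_const_real[of "waiting_rate c x" a "time e"] ae by simp
    show "?g t = waiting_rate c x" if "t \<in> {a..time e} - {time e}" for t
    proof -
      have "\<forall>e'\<in>set (e # h). \<not> time e' \<le> t" using that srt by force
      then have "filter (\<lambda>e. time e \<le> t) (e # h) = []" by (simp add: filter_empty_conv)
      then show ?thesis by simp
    qed
  qed simp
  \<comment> \<open>From \<open>time e\<close> on the filter always keeps \<open>e\<close>, so the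
    integrand is that of \<open>h\<close> started in the updated state.\<close>
  have 2: "(?g has_integral run_cost c (\<lambda>_. 0) (apply_event e x) (time e) h)
      {time e..last (time e # map time h)}"
    by (rule has_integral_eq[OF _ Cons.IH[OF srt]]) auto
  have 3: "matching_cost (\<lambda>_. 0) x [e] = 0" by (cases e) auto
  have "(?g has_integral run_cost c (\<lambda>_. 0) x a (e # h)) {a..last (time e # map time h)}"
    using has_integral_combine[OF ae last_times_ge[OF srt] 1 2] 3 by simp
  then show ?case by simp
qed

lemma run_cost_split:
  "run_cost c f x a h = run_cost c (\<lambda>_. 0) x a h + matching_cost f x h"
proof (induction h arbitrary: x a)
  case (Cons e h)
  then show ?case by (cases e) (simp_all add: fun_upd_def)
qed simp

text \<open>The integral in \<open>total_cost\<close> stops at the last match, whereas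
  \<open>run_cost\<close> runs to the last event; a final match makes the two horizons
  coincide.\<close>

lemma total_cost_snoc_Match:
  assumes "sorted (0 # map time (h @ [Match t]))" and "length (match_times (h @ [Match t])) = K"
  shows "total_cost c f K (h @ [Match t]) = ereal (run_cost c f (\<lambda>_. 0) 0 (h @ [Match t]))"
proof -
  have "integral {0..t} (\<lambda>t'. waiting_rate c (state_at (h @ [Match t]) t')) =
      run_cost c (\<lambda>_. 0) (\<lambda>_. 0) 0 (h @ [Match t])"
    using has_integral_waiting_rate[OF assms(1), of c "\<lambda>_. 0"]
    by (intro integral_unique) (simp add: state_at_def state_after_def del: filter_append)
  then show ?thesis
    using assms(2) run_cost_split[of c f "\<lambda>_. 0" 0 "h @ [Match t]"]
    by (simp add: total_cost_def del: run_cost.simps)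
qed

lemma matching_cost_nonneg:
  "(\<And>x. 0 \<le> f x) \<Longrightarrow> 0 \<le> matching_cost f x h"
  by (induction f x h rule: matching_cost.induct) auto

lemma waiting_rate_nonneg: "(\<And>i. 0 \<le> c i) \<Longrightarrow> 0 \<le> waiting_rate c x"
  by (simp add: waiting_rate_def sum_nonneg)

lemma total_cost_nonneg:
  assumes "\<And>i. 0 \<le> c i" and "\<And>x. 0 \<le> f x"
  shows "0 \<le> total_cost c f K h"
proof -
  \<comment> \<open>For arbitrary \<open>h\<close> integrability is unknown; in the non-integrable
    case \<open>integral\<close> takes its default value 0.\<close>
  have "0 \<le> integral {0..b} (\<lambda>t. waiting_rate c (state_at h t))" for b
    by (cases "(\<lambda>t. waiting_rate c (state_at h t)) integrable_on {0..b}")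
      (auto intro!: integral_nonneg waiting_rate_nonneg assms(1) simp: not_integrable_integral)
  then show ?thesis
    using matching_cost_nonneg[of f] assms(2) by (simp add: total_cost_def)
qed

lemma J_OPT_nonneg:
  assumes "\<And>i. 0 \<le> c i" and "\<And>x. 0 \<le> f x"
  shows "0 \<le> J_OPT c f K A"
  unfolding J_OPT_def by (intro INF_greatest total_cost_nonneg assms)

subsection \<open>Histories matching one tuple at a time\<close>

text \<open>One shape serves three schedules: the run of the policy against the adversary, immediate
  matching (\<open>M = S\<close>), and, with \<open>S\<close> shifted by one, the middle of the
  schedule that holds a reserve.\<close>

primrec rounds :: "(nat \<Rightarrow> real) \<Rightarrow> (nat \<Rightarrow> real) \<Rightarrow> nat \<Rightarrow> 'n::finite history" where
  "rounds S M 0 = []"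
| "rounds S M (Suc k) = rounds S M k @ tuple (S k) @ [Match (M k)]"

lemma fold_rounds [simp]: "fold apply_event (rounds S M k) x = x"
  by (induction k) auto

lemma last_times_rounds [simp]:
  "last (a # map time (rounds S M k :: 'n::finite history)) = (if k = 0 then a else M (k - 1))"
  by (cases k) auto

lemma match_times_rounds [simp]: "match_times (rounds S M k) = map M [0..<k]"
  by (induction k) auto

text \<open>The right-hand side does not mention \<open>M\<close>: this lets offline schedules with
  other match times serve the instance built from the run of the policy.\<close>

lemma arrivals_of_rounds: "arrivals_of (rounds S M k) = concat (map (\<lambda>j. map (Pair (S j)) types) [0..<k])"
  by (induction k) (auto simp: arrivals_of_tuple)

lemma sorted_append_const:
  fixes a b :: real
  assumes a: "sorted (a # xs)" "\<forall>y\<in>set ys. y = b" "last (a # xs) \<le> b"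
  shows "sorted (a # xs @ ys)"
proof -
  have "\<forall>x\<in>set (a # xs). x \<le> last (a # xs)"
    using a(1)
  proof (induction xs arbitrary: a)
    case (Cons x xs)
    from Cons.prems Cons.IH[of x] show ?case by (fastforce simp del: last.simps simp: last_ConsR)
  qed auto
  moreover have "sorted ys"
    using a(2) by (induction ys) auto
  ultimately have "sorted ((a # xs) @ ys)"
    unfolding sorted_append using a by fastforce
  then show ?thesis by simp
qed

lemma sorted_times_tuple:
  "sorted (a # map time h) \<Longrightarrow> last (a # map time h) \<le> s \<Longrightarrow> sorted (a # map time (h @ tuple s))"
  unfolding map_append by (rule sorted_append_const) (auto dest: time_tuple)

lemma sorted_times_Match:
  "sorted (a # map time h) \<Longrightarrow> last (a # map time h) \<le> s \<Longrightarrow> sorted (a # map time (h @ [Match s]))"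
  unfolding map_append by (rule sorted_append_const) auto

lemma sorted_times_rounds:
  assumes "sorted (a # map time h)" and "last (a # map time h) \<le> S 0"
    and "\<And>j. S j \<le> M j" and "\<And>j. M j \<le> S (Suc j)"
  shows "sorted (a # map time (h @ rounds S M k))"
proof (induction k)
  case 0
  then show ?case using assms(1) by simp
next
  case (Suc k)
  have *: "last (a # map time (h @ rounds S M k)) \<le> S k"
    unfolding last_times_append using assms(2,4) by (cases k) auto
  have "sorted (a # map time (((h @ rounds S M k) @ tuple (S k)) @ [Match (M k)]))"
    by (intro sorted_times_Match sorted_times_tuple Suc.IH *)
      (simp only: last_times_append last_times_tuple assms(3))
  then show ?case by simp
qed

lemma waiting_rate_Suc: "waiting_rate c (\<lambda>i. x i + 1) = waiting_rate c x + sum c UNIV"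
  by (simp add: waiting_rate_def algebra_simps sum.distrib)

lemma run_cost_tuple [simp]:
  fixes c :: "'n::finite \<Rightarrow> real"
  shows "run_cost c f x a (tuple s) = (s - a) * waiting_rate c x"
proof -
  have 0: "run_cost c f x s (map (Arrival s) is) = 0" for x and "is" :: "'n list"
    by (induction "is" arbitrary: x) auto
  have "is \<noteq> [] \<Longrightarrow> run_cost c f x a (map (Arrival s) is) = (s - a) * waiting_rate c x"
    for "is" :: "'n list"
    by (cases "is") (simp_all add: 0)
  then show ?thesis by (simp add: tuple_def)
qed

text \<open>The base state \<open>x\<close> waits throughout, and round \<open>j\<close> adds one
  tuple from \<open>S j\<close> to \<open>M j\<close>. A zero \<open>x\<close> prices the policy and
  immediate matching, an all-ones \<open>x\<close> the schedule with a reserve.\<close>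

lemma run_cost_rounds:
  "run_cost c f x a (rounds S M k) = ((if k = 0 then a else M (k - 1)) - a) * waiting_rate c x
     + (\<Sum>j<k. M j - S j) * sum c UNIV + real k * f (\<lambda>i. x i + 1)"
proof (induction k)
  case (Suc k)
  have "run_cost c f x a (rounds S M (Suc k)) = run_cost c f x a (rounds S M k)
      + run_cost c f x (if k = 0 then a else M (k - 1)) (tuple (S k) @ [Match (M k)])"
    by (simp only: rounds.simps run_cost_append fold_rounds last_times_rounds)
  also have "run_cost c f x b (tuple (S k) @ [Match (M k)]) =
      (M k - b) * waiting_rate c x + (M k - S k) * sum c UNIV + f (\<lambda>i. x i + 1)" for b
    unfolding run_cost_append
    by (simp only: last_times_tuple) (simp add: waiting_rate_Suc[simplified] algebra_simps)
  finally show ?case using Suc.IH by (auto simp: algebra_simps)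
qed simp

section \<open>Admissible offline schedules and upper bounds on the optimum\<close>

definition matches_feasible :: "'n::finite history \<Rightarrow> bool" where
  "matches_feasible h \<longleftrightarrow>
     (\<forall>k<length h. \<forall>t. h ! k = Match t \<longrightarrow> state_after (take k h) \<in> feasible)"

lemma matches_feasible_Nil [simp]: "matches_feasible []"
  by (simp add: matches_feasible_def)

lemma matches_feasible_snoc:
  "matches_feasible (h @ [e]) \<longleftrightarrow>
     matches_feasible h \<and> (\<forall>t. e = Match t \<longrightarrow> state_after h \<in> feasible)"
  by (auto simp: matches_feasible_def nth_append less_Suc_eq)

lemma matches_feasible_tuple: "matches_feasible h \<Longrightarrow> matches_feasible (h @ tuple s)"
proof -
  have "matches_feasible h \<Longrightarrow> matches_feasible (h @ map (Arrival s) is)" for "is"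
    by (induction "is" rule: rev_induct)
      (simp_all add: matches_feasible_snoc flip: append_assoc)
  then show "matches_feasible h \<Longrightarrow> matches_feasible (h @ tuple s)"
    by (simp add: tuple_def)
qed

lemma matches_feasible_rounds:
  "matches_feasible h \<Longrightarrow> matches_feasible (h @ rounds S M k)"
proof (induction k)
  case (Suc k)
  have "matches_feasible (((h @ rounds S M k) @ tuple (S k)) @ [Match (M k)])"
    unfolding matches_feasible_snoc
    using matches_feasible_tuple[OF Suc.IH[OF Suc.prems]]
    by (simp add: state_after_append feasible_def)
  then show ?case by simp
qed simp

text \<open>Nonnegativity of the event times is absorbed into the leading \<open>0\<close> of the
  sorted list.\<close>

lemma offline_histories_eq:
  "offline_histories A = {h. arrivals_of h = A \<and> sorted (0 # map time h) \<and> matches_feasible h}"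
  by (auto simp: offline_histories_def matches_feasible_def)

lemma balanced_rounds:
  assumes "0 \<le> S 0" "\<And>j. S j \<le> S (Suc j)"
  shows "balanced K (arrivals_of (rounds S M K :: 'n::finite history))"
proof -
  have sub: "fst ` set (arrivals_of h) \<subseteq> time ` set h" for h :: "'n history"
  proof (induction h)
    case (Cons e h)
    then show ?case by (cases e) auto
  qed simp
  have srt: "sorted (map time h) \<Longrightarrow> sorted (map fst (arrivals_of h))" for h :: "'n history"
  proof (induction h)
    case (Cons e h)
    then show ?case using sub[of h] by (cases e) fastforce+
  qed simp
  \<comment> \<open>The arrivals do not depend on \<open>M\<close>, so their order is read off the
    history that matches at the release times, where monotonicity of \<open>S\<close>
    suffices.\<close>
  have "sorted (0 # map time ([] @ rounds S S K :: 'n history))"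
    by (rule sorted_times_rounds) (use assms in auto)
  moreover have "length (filter (\<lambda>a. snd a = i) (map (Pair s) types)) = 1" for i :: 'n and s :: real
  proof -
    have "length (filter (\<lambda>j. j = i) (types :: 'n list)) = card (set (filter (\<lambda>j. j = i) (types :: 'n list)))"
      by (rule distinct_card[symmetric]) simp
    also have "set (filter (\<lambda>j. j = i) (types :: 'n list)) = {i}" by auto
    finally show ?thesis by (simp add: filter_map comp_def)
  qed
  then have "length (filter (\<lambda>a. snd a = i) (arrivals_of (rounds S M K))) = K" for i :: 'n
    by (induction K) (auto simp: arrivals_of_tuple)
  moreover have "arrivals_of (rounds S M K) = arrivals_of (rounds S S K :: 'n history)"
    by (simp add: arrivals_of_rounds)
  ultimately show ?thesis
    using srt[of "rounds S S K"] sub[of "rounds S S K"] by (force simp: balanced_def)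
qed

lemma J_OPT_le_immediate:
  fixes c :: "'n::finite \<Rightarrow> real"
  assumes "0 \<le> S 0" "\<And>j. S j \<le> S (Suc j)"
  shows "J_OPT c f (Suc m) (arrivals_of (rounds S M (Suc m))) \<le> ereal (real (Suc m) * f (\<lambda>_. 1))"
proof -
  let ?h = "rounds S S (Suc m) :: 'n history"
  have srt: "sorted (0 # map time ([] @ ?h))"
    by (rule sorted_times_rounds) (use assms in auto)
  have "matches_feasible ([] @ ?h)" by (rule matches_feasible_rounds) simp
  moreover have "arrivals_of ?h = arrivals_of (rounds S M (Suc m))"
    by (simp only: arrivals_of_rounds)
  ultimately have "?h \<in> offline_histories (arrivals_of (rounds S M (Suc m)))"
    using srt unfolding offline_histories_eq append_Nil by blast
  then have "J_OPT c f (Suc m) (arrivals_of (rounds S M (Suc m))) \<le> total_cost c f (Suc m) ?h"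
    unfolding J_OPT_def by (rule INF_lower)
  also have "\<dots> = ereal (run_cost c f (\<lambda>_. 0) 0 ?h)"
    using total_cost_snoc_Match[of "rounds S S m @ tuple (S m)" "S m" "Suc m" c f] srt by simp
  also have "run_cost c f (\<lambda>_. 0) 0 ?h = real (Suc m) * f (\<lambda>_. 1)"
    unfolding run_cost_rounds by (simp add: waiting_rate_def)
  finally show ?thesis .
qed

text \<open>The witness holds the first tuple, matches every later one on arrival in the all-twos
  state, and matches the reserve at \<open>S m\<close>. Only the reserve waits, from
  \<open>S 0\<close> to \<open>S m\<close>.\<close>

lemma J_OPT_le_reserve:
  fixes c :: "'n::finite \<Rightarrow> real"
  assumes "0 \<le> S 0" "\<And>j. S j \<le> S (Suc j)"
  shows "J_OPT c f (Suc m) (arrivals_of (rounds S M (Suc m)))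
    \<le> ereal ((S m - S 0) * sum c UNIV + real m * f (\<lambda>_. 2) + f (\<lambda>_. 1))"
proof -
  let ?r = "rounds (S \<circ> Suc) (S \<circ> Suc) m :: 'n history"
  let ?h = "(tuple (S 0) @ ?r) @ [Match (S m)]"
  have last: "last (0 # map time (tuple (S 0) @ ?r)) = S m"
    unfolding last_times_append last_times_tuple last_times_rounds by simp
  have "sorted (0 # map time ([] @ tuple (S 0) :: 'n history))"
    by (rule sorted_times_tuple) (use assms in auto)
  then have "sorted (0 # map time (tuple (S 0) @ ?r))"
    by (intro sorted_times_rounds) (use assms in \<open>auto simp del: list.map last.simps simp: last_times_tuple\<close>)
  then have srt: "sorted (0 # map time ?h)"
    by (rule sorted_times_Match) (simp only: last)
  have "matches_feasible ([] @ tuple (S 0) :: 'n history)"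
    by (rule matches_feasible_tuple) simp
  then have "matches_feasible (tuple (S 0) @ ?r)"
    by (intro matches_feasible_rounds) simp
  then have "matches_feasible ?h"
    unfolding matches_feasible_snoc by (simp add: state_after_def feasible_def)
  moreover have "[0..<Suc m] = 0 # map Suc [0..<m]"
    by (simp add: upt_conv_Cons map_Suc_upt del: upt_Suc)
  then have "arrivals_of ?h = arrivals_of (rounds S M (Suc m))"
    unfolding arrivals_of_append arrivals_of_rounds arrivals_of_tuple by (simp add: comp_def)
  ultimately have "?h \<in> offline_histories (arrivals_of (rounds S M (Suc m)))"
    using srt unfolding offline_histories_eq by blast
  then have "J_OPT c f (Suc m) (arrivals_of (rounds S M (Suc m))) \<le> total_cost c f (Suc m) ?h"
    unfolding J_OPT_def by (rule INF_lower)
  also have "\<dots> = ereal (run_cost c f (\<lambda>_. 0) 0 ?h)"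
    by (rule total_cost_snoc_Match[OF srt]) simp
  also have "run_cost c f (\<lambda>_. 0) 0 ?h = (S m - S 0) * sum c UNIV + real m * f (\<lambda>_. 2) + f (\<lambda>_. 1)"
    unfolding run_cost_append last fold_append o_apply last_times_tuple run_cost_rounds
    by (auto simp: waiting_rate_def numeral_2_eq_2)
  finally show ?thesis .
qed

subsection \<open>The adversary\<close>

text \<open>The default at \<open>Wait\<close> keeps the times of \<open>adversary\<close>
  increasing at every index, even beyond a refusal, as the lemmas on \<open>rounds\<close>
  demand.\<close>

primrec fire_time :: "plan \<Rightarrow> real \<Rightarrow> real" where
  "fire_time Wait s = s"
| "fire_time (Match_at t) s = max s t"
| "fire_time (Match_after t) s = max s t"

text \<open>The gap \<open>\<delta>\<close> must be positive: a \<open>Match_after t\<close> is withheld by an arrival at time \<open>t\<close>.\<close>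

primrec adversary :: "real \<Rightarrow> 'n::finite policy \<Rightarrow> nat \<Rightarrow> 'n history" where
  "adversary \<delta> p 0 = []"
| "adversary \<delta> p (Suc k) =
     (let s = current_time (adversary \<delta> p k) + \<delta>; h = adversary \<delta> p k @ tuple s
      in h @ [Match (fire_time (p h) s)])"

lemma adversary_eq_rounds:
  "adversary \<delta> p k = rounds (\<lambda>j. current_time (adversary \<delta> p j) + \<delta>)
     (\<lambda>j. current_time (adversary \<delta> p (Suc j))) k"
  by (induction k) (simp_all add: Let_def current_time_append)

lemma current_time_adversary_Suc:
  "current_time (adversary \<delta> p k) + \<delta> \<le> current_time (adversary \<delta> p (Suc k))"
proof -
  have "s \<le> fire_time q s" for q s by (cases q) auto
  then show ?thesis by (simp add: Let_def current_time_append)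
qed

lemma online_run_infeasible:
  "state_after h \<notin> feasible \<Longrightarrow> online_run p h ((t, i) # A) = online_run p (h @ [Arrival t i]) A"
  by (subst online_run.simps) simp

text \<open>Starting from the empty state, some type is missing until the tuple is complete, so no
  plan of the policy can interrupt its arrival.\<close>

lemma online_run_tuple:
  fixes p :: "'n::finite policy"
  assumes "state_after h = (\<lambda>_. 0)"
  shows "online_run p h (map (Pair s) types @ B) = online_run p (h @ tuple s) B"
proof -
  have "online_run p (h @ map (Arrival s) us) (map (Pair s) vs @ B) = online_run p (h @ tuple s) B"
    if "us @ vs = types" for us vs :: "'n list"
    using that
  proof (induction vs arbitrary: us)
    case Nil
    then show ?case by (simp add: tuple_def)
  next
    case (Cons v vs)
    have "distinct (us @ v # vs)" using Cons.prems by simp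
    then have "v \<notin> set us" "distinct us" by auto
    then have "state_after (h @ map (Arrival s) us) \<notin> feasible"
      by (auto simp: state_after_append assms fold_arrivals feasible_def intro!: exI[of _ v])
    then show ?case
      using Cons.IH[of "us @ [v]"] Cons.prems by (simp add: online_run_infeasible)
  qed
  from this[of "[]"] show ?thesis by simp
qed

text \<open>The policy sees only the history, so arrivals computed from its answers elicit those
  same answers. The condition on \<open>B\<close> places the next arrival, if any, at the
  adversary's next release time.\<close>

lemma online_run_adversary:
  fixes p :: "'n::finite policy" and \<delta> :: real
  defines "S \<equiv> \<lambda>j. current_time (adversary \<delta> p j) + \<delta>"
  assumes "0 < \<delta>" and "\<And>j. j < k \<Longrightarrow> p (adversary \<delta> p j @ tuple (S j)) \<noteq> Wait"
    and "B = [] \<or> fst (hd B) = S k"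
  shows "online_run p [] (arrivals_of (adversary \<delta> p k) @ B) = online_run p (adversary \<delta> p k) B"
  using assms(3,4)
proof (induction k arbitrary: B)
  case (Suc k)
  let ?h = "adversary \<delta> p k @ tuple (S k)"
  let ?t = "fire_time (p ?h) (S k)"
  have h: "adversary \<delta> p (Suc k) = ?h @ [Match ?t]" by (simp add: S_def Let_def)
  have st: "state_after (adversary \<delta> p k) = (\<lambda>_. 0)"
    by (subst adversary_eq_rounds) (simp add: state_after_def)
  have feas: "state_after ?h \<in> feasible"
    by (simp add: state_after_append st feasible_def)
  have now: "current_time ?h = S k"
    unfolding current_time_append by (rule last_times_tuple)
  \<comment> \<open>The next release is at \<open>?t + \<delta>\<close>; the strict inequality
    ensures that a \<open>Match_after\<close> is executed too.\<close>
  have "B = [] \<or> ?t < fst (hd B)"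
    using Suc.prems(2) \<open>0 < \<delta>\<close> by (auto simp: S_def Let_def current_time_append)
  then have next': "next_match (p ?h) (current_time ?h) B = Some ?t"
    using Suc.prems(1)[of k] unfolding now by (cases "p ?h") auto
  have "online_run p [] (arrivals_of (adversary \<delta> p (Suc k)) @ B) =
      online_run p [] (arrivals_of (adversary \<delta> p k) @ (map (Pair (S k)) types @ B))"
    unfolding h by (simp add: arrivals_of_tuple)
  also have "\<dots> = online_run p (adversary \<delta> p k) (map (Pair (S k)) types @ B)"
    by (rule Suc.IH) (use Suc.prems in \<open>auto simp: hd_append hd_map\<close>)
  also have "\<dots> = online_run p ?h B"
    by (rule online_run_tuple[OF st])
  also have "\<dots> = online_run p (?h @ [Match ?t]) B"
    by (subst online_run.simps) (simp add: feas next' del: append_assoc)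
  finally show ?case unfolding h .
qed simp

lemma online_run_Nil_infeasible: "state_after h \<notin> feasible \<Longrightarrow> online_run p h [] = h"
  by (subst online_run.simps) simp

lemma J_online_adversary:
  fixes p :: "'n::finite policy" and \<delta> :: real
  defines "S \<equiv> \<lambda>j. current_time (adversary \<delta> p j) + \<delta>"
    and "M \<equiv> \<lambda>j. current_time (adversary \<delta> p (Suc j))"
  assumes "0 < \<delta>" and "\<And>j. j \<le> m \<Longrightarrow> p (adversary \<delta> p j @ tuple (S j)) \<noteq> Wait"
  shows "J_online c f p (Suc m) (arrivals_of (rounds S M (Suc m))) =
    ereal ((\<Sum>j<Suc m. M j - S j) * sum c UNIV + real (Suc m) * f (\<lambda>_. 1))"
proof -
  let ?h = "rounds S M (Suc m) :: 'n history"
  have eq: "adversary \<delta> p (Suc m) = ?h"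
    unfolding S_def M_def by (rule adversary_eq_rounds)
  have "online_run p [] (arrivals_of (adversary \<delta> p (Suc m)) @ []) =
      online_run p (adversary \<delta> p (Suc m)) []"
    by (rule online_run_adversary) (use assms in auto)
  also have "\<dots> = adversary \<delta> p (Suc m)"
    unfolding eq by (rule online_run_Nil_infeasible) (simp add: state_after_def feasible_def)
  finally have run: "online_run p [] (arrivals_of ?h) = ?h" unfolding eq by simp
  have "sorted (0 # map time ([] @ ?h))"
    by (rule sorted_times_rounds)
      (use \<open>0 < \<delta>\<close> current_time_adversary_Suc[of \<delta> p] in \<open>auto simp: S_def M_def current_time_def\<close>)
  then have "total_cost c f (Suc m) ?h = ereal (run_cost c f (\<lambda>_. 0) 0 ?h)"
    using total_cost_snoc_Match[of "rounds S M m @ tuple (S m)" "M m" "Suc m" c f] by simp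
  then show ?thesis
    unfolding J_online_def run run_cost_rounds by (simp add: waiting_rate_def)
qed

text \<open>Nothing arrives after the refused tuple, so the run ends with \<open>m\<close> of the
  \<open>Suc m\<close> matches.\<close>

lemma J_online_adversary_Wait:
  fixes p :: "'n::finite policy" and \<delta> :: real
  defines "S \<equiv> \<lambda>j. current_time (adversary \<delta> p j) + \<delta>"
    and "M \<equiv> \<lambda>j. current_time (adversary \<delta> p (Suc j))"
  assumes "0 < \<delta>" and "\<And>j. j < m \<Longrightarrow> p (adversary \<delta> p j @ tuple (S j)) \<noteq> Wait"
    and "p (adversary \<delta> p m @ tuple (S m)) = Wait"
  shows "J_online c f p (Suc m) (arrivals_of (rounds S M (Suc m))) = \<infinity>"
proof -
  have eq: "adversary \<delta> p m = rounds S M m"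
    unfolding S_def M_def by (rule adversary_eq_rounds)
  have st: "state_after (adversary \<delta> p m) = (\<lambda>_. 0)"
    by (simp add: eq state_after_def)
  have "online_run p [] (arrivals_of (adversary \<delta> p m) @ map (Pair (S m)) types) =
      online_run p (adversary \<delta> p m) (map (Pair (S m)) types)"
    by (rule online_run_adversary) (use assms in \<open>auto simp: hd_map\<close>)
  also have "\<dots> = online_run p (adversary \<delta> p m @ tuple (S m)) []"
    using online_run_tuple[OF st, of p "S m" "[]"] by simp
  also have "\<dots> = adversary \<delta> p m @ tuple (S m)"
    by (subst online_run.simps) (simp add: assms(5))
  finally have "online_run p [] (arrivals_of (rounds S M (Suc m))) = rounds S M m @ tuple (S m)"
    by (simp add: eq arrivals_of_tuple)
  then show ?thesis
    by (simp add: J_online_def total_cost_def)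
qed

section \<open>The hard instance\<close>

text \<open>The all-ones state is the least feasible state, so giving it the largest value preserves
  monotonicity.\<close>

lemma cost_function_threshold:
  assumes "0 < \<epsilon>" "\<epsilon> \<le> 1"
  shows "cost_function (\<lambda>x :: 'n::finite state. if x = (\<lambda>_. 1) then 1 else \<epsilon>)"
proof -
  have "x = (\<lambda>_. 1)" if "x \<le> (\<lambda>_. 1)" "x \<in> feasible" for x :: "'n state"
    using that by (auto simp: feasible_def le_fun_def fun_eq_iff intro: antisym)
  then show ?thesis using assms by (auto simp: cost_function_def)
qed

text \<open>A finite positive bound \<open>B\<close> on the optimum avoids dividing by an infimum
  whose positivity is not established; both halves of the theorem follow from this form.\<close>

lemma hard_instance:
  fixes c :: "'n::finite \<Rightarrow> real" and p :: "('n state \<Rightarrow> real) \<Rightarrow> 'n policy"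
  assumes c: "\<And>i. 0 < c i" and "0 < \<eta>"
  obtains f K A B where "cost_function f" "1 \<le> K" "balanced K A" "0 < B"
    "J_OPT c f K A \<le> ereal B" "ereal ((2 - \<eta>) * B) \<le> J_online c f (p f) K A"
proof -
  define C where "C = sum c UNIV"
  have C: "0 < C" unfolding C_def using c by (intro sum_pos) auto
  obtain n :: nat where n: "2 / \<eta> < real n" using reals_Archimedean2 by blast
  define N where "N = real (Suc n)"
  have N: "1 \<le> N" "2 / N \<le> \<eta>"
    using n \<open>0 < \<eta>\<close> by (auto simp: N_def field_simps)
  \<comment> \<open>The reserve pays at most \<open>N * \<delta> * C = 1 / 2\<close> for the gaps
    and at most 1/2 for its cheap matches. With 1 for the final match, this gives the bound
    \<open>W + 2\<close>.\<close>
  define \<delta> where "\<delta> = 1 / (2 * N * C)"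
  define \<epsilon> where "\<epsilon> = 1 / (2 * N)"
  have \<delta>: "0 < \<delta>" using C N by (simp add: \<delta>_def)
  have \<epsilon>: "0 < \<epsilon>" "\<epsilon> \<le> 1" using N by (simp_all add: \<epsilon>_def)
  define f :: "'n state \<Rightarrow> real" where "f = (\<lambda>x. if x = (\<lambda>_. 1) then 1 else \<epsilon>)"
  have f: "cost_function f" unfolding f_def using \<epsilon> by (rule cost_function_threshold)
  have f12: "f (\<lambda>_. Suc 0) = 1" "f (\<lambda>_. 2) = \<epsilon>" by (simp_all add: f_def fun_eq_iff)
  define S where "S = (\<lambda>j. current_time (adversary \<delta> (p f) j) + \<delta>)"
  define M where "M = (\<lambda>j. current_time (adversary \<delta> (p f) (Suc j)))"
  have S0: "0 \<le> S 0" using \<delta> by (simp add: S_def current_time_def)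
  have SM: "S j \<le> M j" "S (Suc j) = M j + \<delta>" for j
    using current_time_adversary_Suc[of \<delta> "p f"] by (simp_all add: S_def M_def)
  have Smono: "S j \<le> S (Suc j)" for j using SM[of j] \<delta> by simp
  show ?thesis
  proof (cases "\<exists>j\<le>n. p f (adversary \<delta> (p f) j @ tuple (S j)) = Wait")
    case True
    \<comment> \<open>Choosing the first refusal guarantees that all earlier rounds are really
      executed.\<close>
    define m where "m = (LEAST j. p f (adversary \<delta> (p f) j @ tuple (S j)) = Wait)"
    have m: "p f (adversary \<delta> (p f) m @ tuple (S m)) = Wait"
      unfolding m_def using True by (auto intro: LeastI)
    have less: "p f (adversary \<delta> (p f) j @ tuple (S j)) \<noteq> Wait" if "j < m" for j
      using not_less_Least[OF that[unfolded m_def]] .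
    have "J_online c f (p f) (Suc m) (arrivals_of (rounds S M (Suc m))) = \<infinity>"
      unfolding S_def M_def
      by (rule J_online_adversary_Wait) (use \<delta> m less in \<open>auto simp: S_def\<close>)
    moreover have "J_OPT c f (Suc m) (arrivals_of (rounds S M (Suc m))) \<le> ereal (real (Suc m) * f (\<lambda>_. 1))"
      by (rule J_OPT_le_immediate[OF S0 Smono])
    ultimately show ?thesis
      \<comment> \<open>Against an infinite online cost any finite positive bound on the optimum
        will do.\<close>
      using balanced_rounds[OF S0 Smono, of "Suc m" M] f
      by (intro that[of f "Suc m" "arrivals_of (rounds S M (Suc m))" "real (Suc m) * f (\<lambda>_. 1)"])
        (simp_all add: f12 del: rounds.simps)
  next
    case False
    define A :: "'n arrivals" where "A = arrivals_of (rounds S M (Suc n))"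
    define W where "W = (\<Sum>j<Suc n. M j - S j) * C"
    have "0 \<le> W" unfolding W_def using C SM(1) by (intro mult_nonneg_nonneg sum_nonneg) auto
    have on: "J_online c f (p f) (Suc n) A = ereal (W + N)"
      unfolding A_def S_def M_def
      by (subst J_online_adversary) (use \<delta> False in \<open>auto simp: S_def M_def W_def C_def N_def f12\<close>)
    have imm: "J_OPT c f (Suc n) A \<le> ereal N"
      using J_OPT_le_immediate[OF S0 Smono, where c=c and f=f and m=n and M=M] by (simp add: A_def f12 N_def del: rounds.simps)
    \<comment> \<open>Telescoping: the span of the releases consists of the policy's holding times
      and the gaps.\<close>
    have "S k - S 0 = (\<Sum>j<k. M j - S j) + real k * \<delta>" for k
      by (induction k) (auto simp: SM(2) algebra_simps)
    from this[of n] have "(S n - S 0) * C = ((\<Sum>j<n. M j - S j) + real n * \<delta>) * C"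
      by (rule arg_cong)
    also have "\<dots> = W - (M n - S n) * C + real n * \<delta> * C"
      by (simp add: W_def algebra_simps)
    also have "\<dots> \<le> W + real n * \<delta> * C" using SM(1)[of n] C by simp
    also have "real n * \<delta> * C \<le> N * \<delta> * C"
      using C \<delta> by (intro mult_right_mono) (auto simp: N_def)
    also have "N * \<delta> * C = 1 / 2" using C N by (simp add: \<delta>_def)
    finally have "(S n - S 0) * C \<le> W + 1 / 2" by simp
    moreover have "real n * \<epsilon> \<le> 1 / 2" by (simp add: \<epsilon>_def N_def field_simps)
    ultimately have "(S n - S 0) * C + real n * \<epsilon> + 1 \<le> W + 2" by simp
    moreover have "J_OPT c f (Suc n) A \<le> ereal ((S n - S 0) * C + real n * \<epsilon> + 1)"
      using J_OPT_le_reserve[OF S0 Smono, where c=c and f=f and m=n and M=M] by (simp add: A_def f12 C_def del: rounds.simps)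
    ultimately have res: "J_OPT c f (Suc n) A \<le> ereal (W + 2)"
      by (meson ereal_less_eq(3) order_trans)
    define B where "B = min N (W + 2)"
    have B: "0 < B" "B \<le> N" "B \<le> W + 2" using N \<open>0 \<le> W\<close> by (auto simp: B_def)
    have "(2 - \<eta>) * B \<le> (2 - 2 / N) * B" using N B by (intro mult_right_mono) auto
    also have "\<dots> = B + (B - 2 * (B / N))" by (simp add: algebra_simps)
    also have "\<dots> \<le> W + N"
    proof (cases "N \<le> W + 2")
      case True
      then have "B = N" by (simp add: B_def)
      then show ?thesis using True N by simp
    next
      case False
      then have "B = W + 2" by (simp add: B_def)
      \<comment> \<open>Divided by \<open>N\<close>, this is the desired bound
        \<open>B - 2 * (B / N) \<le> N - 2\<close>; both factors are nonnegative since
        \<open>N > B \<ge> 2\<close>.\<close>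
      have "0 \<le> (N - B) * (N - 2)"
        using False \<open>0 \<le> W\<close> \<open>B = W + 2\<close> by (intro mult_nonneg_nonneg) auto
      then have "2 * B - 2 * (B / N) \<le> B + N - 2"
        using N by (simp add: field_simps)
      then show ?thesis using \<open>B = W + 2\<close> by simp
    qed
    finally have "ereal ((2 - \<eta>) * B) \<le> J_online c f (p f) (Suc n) A" by (simp add: on)
    moreover have "J_OPT c f (Suc n) A \<le> ereal B" using imm res by (simp add: B_def min_def)
    moreover have "balanced (Suc n) A" unfolding A_def by (rule balanced_rounds[OF S0 Smono])
    ultimately show ?thesis using f B(1) that[of f "Suc n" A B] by simp
  qed
qed

section \<open>From the hard instance to the ratio and the competitive bound\<close>

theorem proposition5:
  fixes c :: "'n::finite \<Rightarrow> real"
  assumes "2 \<le> CARD('n)"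
    and "\<And>i. 0 < c i"
  shows "(\<forall>\<eta>>(0::real). \<forall>\<pi> :: ('n state \<Rightarrow> real) \<Rightarrow> 'n policy.
            \<exists>f K A. cost_function f \<and> 1 \<le> K \<and> balanced K A \<and>
              J_online c f (\<pi> f) K A / J_OPT c f K A \<ge> ereal (2 - \<eta>))
       \<and> (\<forall>\<pi> :: ('n state \<Rightarrow> real) \<Rightarrow> 'n policy. \<forall>\<rho><(2::real). \<not> uniform_competitive_ratio c \<pi> \<rho>)"
proof (intro conjI allI impI)
  fix \<eta> :: real and \<pi> :: "('n state \<Rightarrow> real) \<Rightarrow> 'n policy"
  assume "0 < \<eta>"
  \<comment> \<open>The cap at 1 keeps \<open>2 - min \<eta> 1\<close> positive, which yields the
    nonnegative online cost needed when the denominator shrinks from \<open>B\<close> to the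
    optimum.\<close>
  then have "0 < min \<eta> 1" by simp
  then obtain f K A B where *: "cost_function f" "1 \<le> K" "balanced K A" "0 < B"
    "J_OPT c f K A \<le> ereal B" "ereal ((2 - min \<eta> 1) * B) \<le> J_online c f (\<pi> f) K A"
    using hard_instance[where c=c and p=\<pi> and \<eta>="min \<eta> 1"] assms(2) by blast
  have nonneg: "0 \<le> J_OPT c f K A"
    using assms(2) *(1) by (intro J_OPT_nonneg) (auto simp: cost_function_def less_imp_le)
  have "ereal (2 - \<eta>) \<le> ereal ((2 - min \<eta> 1) * B) / ereal B"
    using *(4) by simp
  also have "\<dots> \<le> J_online c f (\<pi> f) K A / ereal B"
    using *(4,6) by (intro ereal_divide_right_mono) auto
  \<comment> \<open>In \<open>ereal\<close> the inverse of 0 is \<open>\<infinity>\<close>, so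
    antitone inversion also covers a zero optimum.\<close>
  also have "\<dots> \<le> J_online c f (\<pi> f) K A / J_OPT c f K A"
  proof -
    have "0 \<le> ereal ((2 - min \<eta> 1) * B)" using *(4) by simp
    then have "0 \<le> J_online c f (\<pi> f) K A" using *(6) by (rule order_trans)
    then show ?thesis
      unfolding divide_ereal_def using nonneg *(5)
      by (intro ereal_mult_left_mono ereal_inverse_antimono) auto
  qed
  finally show "\<exists>f K A. cost_function f \<and> 1 \<le> K \<and> balanced K A \<and>
      J_online c f (\<pi> f) K A / J_OPT c f K A \<ge> ereal (2 - \<eta>)"
    using *(1-3) by blast
next
  fix \<pi> :: "('n state \<Rightarrow> real) \<Rightarrow> 'n policy" and \<rho> :: real
  assume "\<rho> < 2"
  \<comment> \<open>A nonnegative factor is needed for monotone multiplication in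
    \<open>ereal\<close>.\<close>
  define r where "r = max \<rho> 0"
  have r: "r < 2" "0 \<le> r" "\<rho> \<le> r" using \<open>\<rho> < 2\<close> by (auto simp: r_def)
  \<comment> \<open>With this slack the guaranteed ratio is \<open>2 - (2 - r) / 2\<close>, the
    midpoint of \<open>r\<close> and 2, hence strictly above \<open>r\<close>.\<close>
  then have "0 < (2 - r) / 2" by simp
  then obtain f K A B where *: "cost_function f" "1 \<le> K" "balanced K A" "0 < B"
    "J_OPT c f K A \<le> ereal B" "ereal ((2 - (2 - r) / 2) * B) \<le> J_online c f (\<pi> f) K A"
    using hard_instance[where c=c and p=\<pi> and \<eta>="(2 - r) / 2"] assms(2) by blast
  have nonneg: "0 \<le> J_OPT c f K A"
    using assms(2) *(1) by (intro J_OPT_nonneg) (auto simp: cost_function_def less_imp_le)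
  have "ereal \<rho> * J_OPT c f K A \<le> ereal r * J_OPT c f K A"
    using r nonneg by (intro ereal_mult_right_mono) auto
  also have "\<dots> \<le> ereal r * ereal B"
    using r *(5) by (intro ereal_mult_left_mono) auto
  also have "\<dots> < ereal ((2 - (2 - r) / 2) * B)"
  proof -
    have "r < 2 - (2 - r) / 2" using r(1) by (simp add: field_simps)
    then show ?thesis using mult_strict_right_mono[OF _ *(4)] by simp
  qed
  also note *(6)
  finally show "\<not> uniform_competitive_ratio c \<pi> \<rho>"
    using *(1,3) unfolding uniform_competitive_ratio_def not_all not_imp not_le by blast
qed

end
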